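(* Let $\mathbf A$ be a finite Boolean algebra and $P$ a positive probability on $\mathbf A$ (extended to the conditional probability $P(a\mid b)=P(ab)/P(b)$ on $A\times A'$). Then for every $t\in\mathbb{T}(A)$, $P^*(t)=\mu_P([t]_{\mathfrak C})$, where $[t]_{\mathfrak C}$ is the element of $\mathcal{C}(\mathbf A)$ represented by $t$ (reading the constants $1,0$ as $\top^*,\neg\top^*$).
   Context: $\mathbf A=(A,\wedge,\vee,\neg,\bot,\top)$ is a finite Boolean algebra with atoms $\alpha_1,\ldots,\alpha_n$; $ab=a\wedge b$, $\bar a=\neg a$, $A'=A\setminus\{\bot\}$. $\Omega$ is the set of Boolean homomorphisms $w:\mathbf A\to\{0,1\}$ (identified with atoms); $w\models a$ means $w(a)=1$. A basic conditional is a pair $(a\mid b)$, $a\in A$, $b\in A'$. $\mathbb{T}(A)$ is the set of terms built from basic conditionals (as variables) and constants $0,1$ using $\neg,\wedge,\vee$. $\mathbf b(t)$ is the disjunction of antecedents of basic conditionals occurring in $t$ ($\top$ if $t\in\{0,1\}$). The $w$-reduct $t^w$: replace each occurring $(a_i\mid b_i)$ by $1$ if $w\models a_ib_i$, by $0$ if $w\models\bar a_ib_i$ (unchanged if $w\models\bar b_i$), then apply $\neg1:=0$, $\neg0:=1$, $r\wedge1=1\wedge r:=r$, $r\wedge0=0\wedge r:=0$, $r\vee1=1\vee r:=1$, $r\vee0=0\vee r:=r$ until no rule applies. For $X:\Omega\to\mathbb R$, $\mathbb P(X\mid b)=\sum_wX(w)P(w\mid b)$. $X_t:\Omega\to[0,1]$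 is defined recursively by $X_1\equiv1$, $X_0\equiv0$, $X_t(w)=\mathbb P(X_{t^w}\mid\mathbf b(t^w))$ (for $w\models\neg\mathbf b(t)$, $t^w=t$ and $X_t(w)=\mathbb P(X_t\mid\mathbf b(t))$, depending only on $X_t$ at worlds satisfying $\mathbf b(t)$); $P^*(t)=\mathbb P(X_t\mid\mathbf b(t))$. $\mathcal{C}(\mathbf A)$ is the quotient of the free Boolean algebra $\mathrm{Free}(A|A')$ (signature $\wedge,\vee,\neg,\top^*$) generated by the pairs $(a\mid b)$, $a\in A$, $b\in A'$, by the smallest congruence $\equiv_{\mathfrak C}$ such that $(b\mid b)\equiv_{\mathfrak C}\top^*$; $(a_1\mid b)\wedge(a_2\mid b)\equiv_{\mathfrak C}(a_1\wedge a_2\mid b)$; $\neg(a\mid b)\equiv_{\mathfrak C}(\neg a\mid b)$; $(a\wedge b\mid b)\equiv_{\mathfrak C}(a\mid b)$; $(a\mid b)\wedge(b\mid c)\equiv_{\mathfrak C}(a\mid c)$ whenever $a\le b\le c$. The atoms of $\mathcal{C}(\mathbf A)$ are exactly the classes of the terms $\omega_{\langle\beta\rangle}=(\beta_1\mid\top)\wedge(\beta_2\mid\overline{\beta_1})\wedge\cdots\wedge(\beta_{n-1}\mid\overline{\beta_1}\wedge\cdots\wedge\overline{\beta_{n-2}})$ for sequences $\langle\beta_1,\ldots,\beta_{n-1}\rangle$ of pairwise different atoms of $\mathbf A$, and $\mu_P$ is the probability on $\mathcal{C}(\mathbf A)$ assigning to the class of $\omega_{\langle\beta\rangle}$ the value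 $P(\beta_1)\,P(\beta_2\mid\overline{\beta_1})\cdots P(\beta_{n-1}\mid\overline{\beta_1}\wedge\cdots\wedge\overline{\beta_{n-2}})$ (it satisfies $\mu_P((a\mid b))=P(ab)/P(b)$). *)

theory Defs
  imports Complex_Main
begin

subsection \<open>Boolean algebras, worlds and probabilities\<close>

definition is_atom :: "'a::boolean_algebra \<Rightarrow> bool" where
  "is_atom a \<longleftrightarrow> a \<noteq> bot \<and> (\<forall>b. b \<le> a \<longrightarrow> b = bot \<or> b = a)"

definition worlds :: "('a::boolean_algebra \<Rightarrow> bool) set" where
  "worlds = {w. w bot = bot \<and> w top = top \<and> (\<forall>a. w (- a) = - w a) \<and>
     (\<forall>a b. w (inf a b) = inf (w a) (w b)) \<and> (\<forall>a b. w (sup a b) = sup (w a) (w b))}"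

definition atom_of :: "('a::boolean_algebra \<Rightarrow> bool) \<Rightarrow> 'a" where
  "atom_of w = (THE \<alpha>. is_atom \<alpha> \<and> w \<alpha>)"

definition probability :: "('a::boolean_algebra \<Rightarrow> real) \<Rightarrow> bool" where
  "probability P \<longleftrightarrow> (\<forall>a. 0 \<le> P a) \<and> P top = 1 \<and>
     (\<forall>a b. inf a b = bot \<longrightarrow> P (sup a b) = P a + P b)"

definition positive :: "('a::boolean_algebra \<Rightarrow> real) \<Rightarrow> bool" where
  "positive P \<longleftrightarrow> (\<forall>a. a \<noteq> bot \<longrightarrow> 0 < P a)"

definition cond_prob :: "('a::boolean_algebra \<Rightarrow> real) \<Rightarrow> 'a \<Rightarrow> 'a \<Rightarrow> real" where
  "cond_prob P a b = P (inf a b) / P b"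

definition expect ::
  "('a::{finite,boolean_algebra} \<Rightarrow> real) \<Rightarrow> (('a \<Rightarrow> bool) \<Rightarrow> real) \<Rightarrow> 'a \<Rightarrow> real" where
  "expect P X b = (\<Sum>w\<in>worlds. X w * cond_prob P (atom_of w) b)"

lemma atom_of_world:
  fixes w :: "'a::{finite,boolean_algebra} \<Rightarrow> bool"
  assumes "w \<in> worlds"
  shows "is_atom (atom_of w) \<and> w (atom_of w)"
proof -
  have hom: "\<not> w bot" "w top" "\<And>a. w (- a) = (\<not> w a)" "\<And>a b. w (inf a b) = (w a \<and> w b)"
    using assms by (auto simp: worlds_def)
  define m where "m = Inf_fin {a. w a}"
  have le: "m \<le> a" if "w a" for a
    unfolding m_def using that by (intro Inf_fin.coboundedI) auto
  have wm: "w m"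
  proof -
    have "F \<subseteq> {a. w a} \<longrightarrow> w (Inf_fin F)" if "finite F" "F \<noteq> {}" for F :: "'a set"
      using that by (induction rule: finite_ne_induct) (auto simp: hom)
    from this[of "{a. w a}"] show ?thesis unfolding m_def using hom(2) by auto
  qed
  have "is_atom m"
    unfolding is_atom_def
  proof (intro conjI allI impI)
    show "m \<noteq> bot" using wm hom by auto
    fix b assume b: "b \<le> m"
    show "b = bot \<or> b = m"
    proof (cases "w b")
      case True
      then show ?thesis using le[of b] b by auto
    next
      case False
      then have "m \<le> - b" using le hom by auto
      with b have "b \<le> - b" by (rule order_trans)
      then have "b \<le> inf b (- b)" by (intro le_infI order_refl)
      then show ?thesis by (simp add: bot_unique)
    qed
  qed
  moreover have "\<alpha> = m" if "is_atom \<alpha>" "w \<alpha>" for \<alpha>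
    using that le[of \<alpha>] \<open>is_atom m\<close> unfolding is_atom_def by blast
  ultimately have "atom_of w = m"
    unfolding atom_of_def using wm by (intro the_equality) blast+
  then show ?thesis using \<open>is_atom m\<close> wm by simp
qed

lemma cond_prob_outside:
  fixes w :: "'a::{finite,boolean_algebra} \<Rightarrow> bool"
  assumes "probability P" "w \<in> worlds" "\<not> w b"
  shows "cond_prob P (atom_of w) b = 0"
proof -
  have at: "is_atom (atom_of w)" "w (atom_of w)" using atom_of_world assms by auto
  have "\<not> w (inf (atom_of w) b)" using assms by (auto simp: worlds_def)
  then have "inf (atom_of w) b \<noteq> atom_of w" using at by auto
  then have "inf (atom_of w) b = bot" using at(1) unfolding is_atom_def by (meson inf_le1)
  moreover have "P bot = 0"
  proof -
    have "P (sup bot bot) = P bot + P bot"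
      using assms(1) inf_bot_left[of bot] unfolding probability_def by metis
    then show ?thesis by simp
  qed
  ultimately show ?thesis by (simp add: cond_prob_def)
qed


subsection \<open>Terms over basic conditionals\<close>

datatype (basics: 'c) bterm =
    Basic 'c
  | Zero
  | One
  | Neg "'c bterm"
  | Conj "'c bterm" "'c bterm"
  | Disj "'c bterm" "'c bterm"

text \<open>The basic conditional \<open>(a | b)\<close> is the pair \<open>(a, b)\<close>; the requirement \<open>b \<noteq> bot\<close> is
  imposed by membership in the set \<open>cond_terms\<close>.\<close>

type_synonym 'a cond_term = "('a \<times> 'a) bterm"

definition cond_terms :: "'a::boolean_algebra cond_term set" where
  "cond_terms = {t. \<forall>(a, b)\<in>basics t. b \<noteq> bot}"

lemma cond_terms_simps [simp]:
  "Basic (a, b) \<in> cond_terms \<longleftrightarrow> b \<noteq> bot"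
  "Zero \<in> cond_terms" "One \<in> cond_terms"
  "Neg t \<in> cond_terms \<longleftrightarrow> t \<in> cond_terms"
  "Conj s t \<in> cond_terms \<longleftrightarrow> s \<in> cond_terms \<and> t \<in> cond_terms"
  "Disj s t \<in> cond_terms \<longleftrightarrow> s \<in> cond_terms \<and> t \<in> cond_terms"
  by (auto simp: cond_terms_def)

text \<open>The value \<open>top\<close> is used for every term in which no basic conditional occurs, so besides the
  constants also for terms such as \<open>Neg One\<close>, whose disjunction of antecedents would be empty.\<close>

definition antecedent :: "'a::boolean_algebra cond_term \<Rightarrow> 'a" where
  "antecedent t = (if basics t = {} then top else Sup_fin (snd ` basics t))"


subsection \<open>Reducts\<close>

primrec world_subst :: "('a::boolean_algebra \<Rightarrow> bool) \<Rightarrow> 'a cond_term \<Rightarrow> 'a cond_term" where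
  "world_subst w (Basic c) =
     (if w (inf (fst c) (snd c)) then One
      else if w (inf (- fst c) (snd c)) then Zero
      else Basic c)"
| "world_subst w Zero = Zero"
| "world_subst w One = One"
| "world_subst w (Neg t) = Neg (world_subst w t)"
| "world_subst w (Conj s t) = Conj (world_subst w s) (world_subst w t)"
| "world_subst w (Disj s t) = Disj (world_subst w s) (world_subst w t)"

inductive reduces :: "'c bterm \<Rightarrow> 'c bterm \<Rightarrow> bool" where
  "reduces (Neg One) Zero"
| "reduces (Neg Zero) One"
| "reduces (Conj r One) r"
| "reduces (Conj One r) r"
| "reduces (Conj r Zero) Zero"
| "reduces (Conj Zero r) Zero"
| "reduces (Disj r One) One"
| "reduces (Disj One r) One"
| "reduces (Disj r Zero) r"
| "reduces (Disj Zero r) r"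
| "reduces s t \<Longrightarrow> reduces (Neg s) (Neg t)"
| "reduces s t \<Longrightarrow> reduces (Conj s r) (Conj t r)"
| "reduces s t \<Longrightarrow> reduces (Conj r s) (Conj r t)"
| "reduces s t \<Longrightarrow> reduces (Disj s r) (Disj t r)"
| "reduces s t \<Longrightarrow> reduces (Disj r s) (Disj r t)"

definition reduct :: "('a::boolean_algebra \<Rightarrow> bool) \<Rightarrow> 'a cond_term \<Rightarrow> 'a cond_term" where
  "reduct w t = (THE r. reduces\<^sup>*\<^sup>* (world_subst w t) r \<and> (\<nexists>s. reduces r s))"

text \<open>The normal form exists and is unique; it is computed bottom-up by \<open>nf\<close>.\<close>

primrec nf :: "'c bterm \<Rightarrow> 'c bterm" where
  "nf (Basic c) = Basic c"
| "nf Zero = Zero"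
| "nf One = One"
| "nf (Neg t) = (if nf t = One then Zero else if nf t = Zero then One else Neg (nf t))"
| "nf (Conj s t) =
     (if nf s = Zero \<or> nf t = Zero then Zero
      else if nf s = One then nf t else if nf t = One then nf s else Conj (nf s) (nf t))"
| "nf (Disj s t) =
     (if nf s = One \<or> nf t = One then One
      else if nf s = Zero then nf t else if nf t = Zero then nf s else Disj (nf s) (nf t))"

lemma nf_reduces: "reduces s t \<Longrightarrow> nf s = nf t"
  by (induction rule: reduces.induct) auto

lemma nf_reduces_star: "reduces\<^sup>*\<^sup>* s t \<Longrightarrow> nf s = nf t"
  by (induction rule: rtranclp_induct) (auto dest: nf_reduces)

inductive_cases reduces_atomic: "reduces (Basic c) t" "reduces Zero t" "reduces One t"
inductive_cases reduces_compound: "reduces (Neg s) t" "reduces (Conj r s) t" "reduces (Disj r s) t"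

lemma nf_irreducible: "\<not> reduces (nf t) s"
  by (induction t arbitrary: s)
    (auto split: if_splits elim: reduces_atomic elim!: reduces_compound)

lemma reduces_star_map:
  assumes "\<And>s t. reduces s t \<Longrightarrow> reduces (f s) (f t)" "reduces\<^sup>*\<^sup>* s t"
  shows "reduces\<^sup>*\<^sup>* (f s) (f t)"
  using assms(2) by induction (auto intro: rtranclp.rtrancl_into_rtrancl assms(1))

lemma reduces_star_cong:
  "reduces\<^sup>*\<^sup>* s s' \<Longrightarrow> reduces\<^sup>*\<^sup>* (Neg s) (Neg s')"
  "reduces\<^sup>*\<^sup>* s s' \<Longrightarrow> reduces\<^sup>*\<^sup>* (Conj s r) (Conj s' r)"
  "reduces\<^sup>*\<^sup>* s s' \<Longrightarrow> reduces\<^sup>*\<^sup>* (Conj r s) (Conj r s')"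
  "reduces\<^sup>*\<^sup>* s s' \<Longrightarrow> reduces\<^sup>*\<^sup>* (Disj s r) (Disj s' r)"
  "reduces\<^sup>*\<^sup>* s s' \<Longrightarrow> reduces\<^sup>*\<^sup>* (Disj r s) (Disj r s')"
  by (auto intro: reduces.intros(11-15) reduces_star_map[where f = Neg]
      reduces_star_map[where f = "\<lambda>s. Conj s r"] reduces_star_map[where f = "Conj r"]
      reduces_star_map[where f = "\<lambda>s. Disj s r"] reduces_star_map[where f = "Disj r"])

lemma reduces_star_nf: "reduces\<^sup>*\<^sup>* t (nf t)"
proof (induction t)
  case (Neg t)
  then have "reduces\<^sup>*\<^sup>* (Neg t) (Neg (nf t))" by (rule reduces_star_cong(1))
  moreover have "reduces\<^sup>*\<^sup>* (Neg (nf t)) (nf (Neg t))" by (auto intro: r_into_rtranclp reduces.intros(1-10))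
  ultimately show ?case by (rule rtranclp_trans)
next
  case (Conj s t)
  then have "reduces\<^sup>*\<^sup>* (Conj s t) (Conj (nf s) (nf t))"
    using reduces_star_cong(2)[of s "nf s" t]
      reduces_star_cong(3)[of t "nf t" "nf s"] by simp
  moreover have "reduces\<^sup>*\<^sup>* (Conj (nf s) (nf t)) (nf (Conj s t))" by (auto intro: r_into_rtranclp reduces.intros(1-10))
  ultimately show ?case by (rule rtranclp_trans)
next
  case (Disj s t)
  then have "reduces\<^sup>*\<^sup>* (Disj s t) (Disj (nf s) (nf t))"
    using reduces_star_cong(4)[of s "nf s" t]
      reduces_star_cong(5)[of t "nf t" "nf s"] by simp
  moreover have "reduces\<^sup>*\<^sup>* (Disj (nf s) (nf t)) (nf (Disj s t))" by (auto intro: r_into_rtranclp reduces.intros(1-10))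
  ultimately show ?case by (rule rtranclp_trans)
qed auto

lemma irreducible_nf: "(\<nexists>s. reduces t s) \<Longrightarrow> nf t = t"
  using reduces_star_nf[of t] by (metis converse_rtranclpE)

lemma reduct_eq_nf: "reduct w t = nf (world_subst w t)"
  unfolding reduct_def
proof (rule the_equality)
  show "reduces\<^sup>*\<^sup>* (world_subst w t) (nf (world_subst w t)) \<and>
      (\<nexists>s. reduces (nf (world_subst w t)) s)"
    using reduces_star_nf nf_irreducible by blast
next
  fix r assume "reduces\<^sup>*\<^sup>* (world_subst w t) r \<and> (\<nexists>s. reduces r s)"
  then show "r = nf (world_subst w t)"
    using nf_reduces_star irreducible_nf by metis
qed


subsection \<open>The random quantity of a term\<close>

primrec weight :: "'c bterm \<Rightarrow> nat" where
  "weight (Basic c) = 2"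
| "weight Zero = 1"
| "weight One = 1"
| "weight (Neg t) = Suc (weight t)"
| "weight (Conj s t) = Suc (weight s + weight t)"
| "weight (Disj s t) = Suc (weight s + weight t)"

lemma weight_nf: "weight (nf t) \<le> weight t"
  by (induction t) auto

lemma weight_world_subst: "weight (world_subst w t) \<le> weight t"
  by (induction t) auto

lemma weight_reduct: "weight (reduct w t) \<le> weight t"
  unfolding reduct_eq_nf using weight_nf weight_world_subst le_trans by blast

lemma weight_world_subst_less:
  assumes "(a, b) \<in> basics t" "w \<in> worlds" "w b"
  shows "weight (world_subst w t) < weight t"
  using assms(1)
proof (induction t)
  case (Basic c)
  with assms show ?case by (auto simp: worlds_def)
next
  case (Conj s t)
  then consider "weight (world_subst w s) < weight s" | "weight (world_subst w t) < weight t"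
    by auto
  then show ?case
    using weight_world_subst[of w s] weight_world_subst[of w t] by cases simp_all
next
  case (Disj s t)
  then consider "weight (world_subst w s) < weight s" | "weight (world_subst w t) < weight t"
    by auto
  then show ?case
    using weight_world_subst[of w s] weight_world_subst[of w t] by cases simp_all
qed auto

lemma weight_pos: "0 < weight t"
  by (cases t) auto

lemma weight_nf_less:
  assumes "basics t = {}" "t \<noteq> One" "t \<noteq> Zero"
  shows "weight (nf t) < weight t"
proof -
  have "nf t = One \<or> nf t = Zero" using assms(1) by (induction t) auto
  then have "weight (nf t) = 1" by auto
  moreover have "1 < weight t" using assms by (cases t) (simp_all add: weight_pos)
  ultimately show ?thesis by simp
qed

lemma world_antecedent:
  assumes "w \<in> worlds" "basics t \<noteq> {}" "w (antecedent t)"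
  shows "\<exists>(a, b)\<in>basics t. w b"
proof -
  have hom: "w (sup a b) \<longleftrightarrow> w a \<or> w b" for a b
    using assms(1) by (simp add: worlds_def)
  have sup: "w (Sup_fin F) \<longleftrightarrow> (\<exists>b\<in>F. w b)" if "finite F" "F \<noteq> {}" for F
    using that by (induction rule: finite_ne_induct) (simp_all add: hom)
  have "finite (snd ` basics t)" by (induction t) (simp_all add: image_Un)
  then have "\<exists>b\<in>snd ` basics t. w b"
    using assms(2,3) sup[of "snd ` basics t"] by (simp add: antecedent_def)
  then show ?thesis by auto
qed

lemma weight_reduct_less:
  assumes "w \<in> worlds" "w (antecedent t)" "t \<noteq> One" "t \<noteq> Zero"
  shows "weight (reduct w t) < weight t"
proof (cases "basics t = {}")
  case True
  then have "world_subst w t = t" by (induction t) auto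
  then show ?thesis using weight_nf_less[OF True] assms by (simp add: reduct_eq_nf)
next
  case False
  then obtain a b where "(a, b) \<in> basics t" "w b" using world_antecedent assms by fastforce
  then have "weight (world_subst w t) < weight t" using weight_world_subst_less assms by blast
  then show ?thesis unfolding reduct_eq_nf using weight_nf le_less_trans by blast
qed

text \<open>The recursion \<open>X\<^sub>t(w) = \<P>(X\<^sub>t\<^sub>' | b(t'))\<close> with \<open>t'\<close> the \<open>w\<close>-reduct of \<open>t\<close> may
  have \<open>t' = t\<close>. It is well-founded because only the worlds satisfying \<open>b(t')\<close> contribute to the
  conditional expectation, so the sum is restricted to these; \<open>rand_quant_rec\<close> below states the
  recursion with the full conditional expectation.\<close>

function rand_quant ::
  "('a::{finite,boolean_algebra} \<Rightarrow> real) \<Rightarrow> 'a cond_term \<Rightarrow> ('a \<Rightarrow> bool) \<Rightarrow> real" where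
  "rand_quant P t w =
     (if t = One then 1 else if t = Zero then 0
      else (\<Sum>v | v \<in> worlds \<and> v (antecedent (reduct w t)).
              rand_quant P (reduct w t) v * cond_prob P (atom_of v) (antecedent (reduct w t))))"
  by pat_completeness auto

termination
proof (relation "inv_image (less_than <*lex*> less_than)
    (\<lambda>(P, t, w). (weight t, if w \<in> worlds \<and> w (antecedent t) then 0 else 1))", goal_cases)
  case 1
  show ?case by auto
next
  case (2 P t w v)
  then show ?case
    using weight_reduct_less[of w t] weight_reduct[of w t] by (auto simp: le_less)
qed

declare rand_quant.simps [simp del]

lemma rand_quant_One: "rand_quant P One w = 1"
  by (simp add: rand_quant.simps)

lemma rand_quant_Zero: "rand_quant P Zero w = 0"
  by (simp add: rand_quant.simps)

lemma rand_quant_rec: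
  assumes "probability P" "t \<noteq> One" "t \<noteq> Zero"
  shows "rand_quant P t w = expect P (rand_quant P (reduct w t)) (antecedent (reduct w t))"
  unfolding expect_def
  by (subst rand_quant.simps, simp only: assms if_False, rule sum.mono_neutral_left)
    (auto simp: cond_prob_outside assms)

definition Pstar :: "('a::{finite,boolean_algebra} \<Rightarrow> real) \<Rightarrow> 'a cond_term \<Rightarrow> real" where
  "Pstar P t = expect P (rand_quant P t) (antecedent t)"


subsection \<open>The free Boolean algebra on the basic conditionals\<close>

text \<open>Terms modulo the equational theory of Boolean algebras. The relation is reflexive exactly on
  \<open>cond_terms\<close>, so that only pairs \<open>(a, b)\<close> with \<open>b \<noteq> bot\<close> are generators.\<close>

inductive free_eq :: "'a::boolean_algebra cond_term \<Rightarrow> 'a cond_term \<Rightarrow> bool" where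
  refl: "t \<in> cond_terms \<Longrightarrow> free_eq t t"
| sym: "free_eq s t \<Longrightarrow> free_eq t s"
| trans: "free_eq r s \<Longrightarrow> free_eq s t \<Longrightarrow> free_eq r t"
| cong_Neg: "free_eq s t \<Longrightarrow> free_eq (Neg s) (Neg t)"
| cong_Conj: "free_eq s s' \<Longrightarrow> free_eq t t' \<Longrightarrow> free_eq (Conj s t) (Conj s' t')"
| cong_Disj: "free_eq s s' \<Longrightarrow> free_eq t t' \<Longrightarrow> free_eq (Disj s t) (Disj s' t')"
| Conj_assoc: "r \<in> cond_terms \<Longrightarrow> s \<in> cond_terms \<Longrightarrow> t \<in> cond_terms \<Longrightarrow>
    free_eq (Conj (Conj r s) t) (Conj r (Conj s t))"
| Disj_assoc: "r \<in> cond_terms \<Longrightarrow> s \<in> cond_terms \<Longrightarrow> t \<in> cond_terms \<Longrightarrow>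
    free_eq (Disj (Disj r s) t) (Disj r (Disj s t))"
| Conj_comm: "s \<in> cond_terms \<Longrightarrow> t \<in> cond_terms \<Longrightarrow> free_eq (Conj s t) (Conj t s)"
| Disj_comm: "s \<in> cond_terms \<Longrightarrow> t \<in> cond_terms \<Longrightarrow> free_eq (Disj s t) (Disj t s)"
| Conj_absorb: "s \<in> cond_terms \<Longrightarrow> t \<in> cond_terms \<Longrightarrow> free_eq (Conj s (Disj s t)) s"
| Disj_absorb: "s \<in> cond_terms \<Longrightarrow> t \<in> cond_terms \<Longrightarrow> free_eq (Disj s (Conj s t)) s"
| distrib: "r \<in> cond_terms \<Longrightarrow> s \<in> cond_terms \<Longrightarrow> t \<in> cond_terms \<Longrightarrow>
    free_eq (Disj r (Conj s t)) (Conj (Disj r s) (Disj r t))"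
| Conj_One: "t \<in> cond_terms \<Longrightarrow> free_eq (Conj t One) t"
| Disj_Neg: "t \<in> cond_terms \<Longrightarrow> free_eq (Disj t (Neg t)) One"
| Conj_Neg: "t \<in> cond_terms \<Longrightarrow> free_eq (Conj t (Neg t)) (Neg One)"
| Zero_eq: "free_eq Zero (Neg One)"

lemma free_eq_cond_terms: "free_eq s t \<Longrightarrow> s \<in> cond_terms \<and> t \<in> cond_terms"
  by (induction rule: free_eq.induct) auto

lemma free_eq_refl_iff: "free_eq t t \<longleftrightarrow> t \<in> cond_terms"
  using free_eq_cond_terms free_eq.refl by blast

quotient_type (overloaded) 'a free_alg = "'a::boolean_algebra cond_term" / partial: free_eq
proof (rule part_equivpI)
  show "\<exists>t :: 'a cond_term. free_eq t t" using free_eq.refl[of One] by auto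
  show "symp (free_eq :: 'a cond_term \<Rightarrow> _)" by (rule sympI) (rule free_eq.sym)
  show "transp (free_eq :: 'a cond_term \<Rightarrow> _)" by (rule transpI) (rule free_eq.trans)
qed

instantiation free_alg :: (boolean_algebra) boolean_algebra
begin

lift_definition inf_free_alg :: "'a free_alg \<Rightarrow> 'a free_alg \<Rightarrow> 'a free_alg" is Conj
  by (rule free_eq.cong_Conj)
lift_definition sup_free_alg :: "'a free_alg \<Rightarrow> 'a free_alg \<Rightarrow> 'a free_alg" is Disj
  by (rule free_eq.cong_Disj)
lift_definition uminus_free_alg :: "'a free_alg \<Rightarrow> 'a free_alg" is Neg
  by (rule free_eq.cong_Neg)
lift_definition top_free_alg :: "'a free_alg" is One
  by (simp add: free_eq.refl)
lift_definition bot_free_alg :: "'a free_alg" is "Neg One"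
  by (simp add: free_eq.refl)
definition minus_free_alg :: "'a free_alg \<Rightarrow> 'a free_alg \<Rightarrow> 'a free_alg" where
  "minus_free_alg x y = inf x (- y)"
definition less_eq_free_alg :: "'a free_alg \<Rightarrow> 'a free_alg \<Rightarrow> bool" where
  "less_eq_free_alg x y \<longleftrightarrow> inf x y = x"
definition less_free_alg :: "'a free_alg \<Rightarrow> 'a free_alg \<Rightarrow> bool" where
  "less_free_alg x y \<longleftrightarrow> x \<le> y \<and> \<not> y \<le> x"

instance
proof -
  note T = free_eq_refl_iff
  have ia: "inf (inf x y) z = inf x (inf y z)" for x y z :: "'a free_alg"
    by transfer (simp add: T free_eq.Conj_assoc)
  have sa: "sup (sup x y) z = sup x (sup y z)" for x y z :: "'a free_alg"
    by transfer (simp add: T free_eq.Disj_assoc)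
  have ic: "inf x y = inf y x" for x y :: "'a free_alg"
    by transfer (simp add: T free_eq.Conj_comm)
  have sc: "sup x y = sup y x" for x y :: "'a free_alg"
    by transfer (simp add: T free_eq.Disj_comm)
  have iab: "inf x (sup x y) = x" for x y :: "'a free_alg"
    by transfer (simp add: T free_eq.Conj_absorb)
  have sab: "sup x (inf x y) = x" for x y :: "'a free_alg"
    by transfer (simp add: T free_eq.Disj_absorb)
  have dist: "sup x (inf y z) = inf (sup x y) (sup x z)" for x y z :: "'a free_alg"
    by transfer (simp add: T free_eq.distrib)
  have it: "inf x top = x" for x :: "'a free_alg"
    by transfer (simp add: T free_eq.Conj_One)
  have sn: "sup x (- x) = top" for x :: "'a free_alg"
    by transfer (simp add: T free_eq.Disj_Neg)
  have inn: "inf x (- x) = bot" for x :: "'a free_alg"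
    by transfer (simp add: T free_eq.Conj_Neg)
  have ii: "inf x x = x" for x :: "'a free_alg" using iab sab by metis
  have le_sup: "x \<le> y \<longleftrightarrow> sup x y = y" for x y :: "'a free_alg"
    unfolding less_eq_free_alg_def using iab sab ic sc by metis
  show "OFCLASS('a free_alg, boolean_algebra_class)"
  proof
    fix x y z :: "'a free_alg"
    show "(x < y) = (x \<le> y \<and> \<not> y \<le> x)" by (rule less_free_alg_def)
    show "x \<le> x" by (simp add: less_eq_free_alg_def ii)
    show "x \<le> y \<Longrightarrow> y \<le> z \<Longrightarrow> x \<le> z" unfolding less_eq_free_alg_def using ia by metis
    show "x \<le> y \<Longrightarrow> y \<le> x \<Longrightarrow> x = y" unfolding less_eq_free_alg_def using ic by metis
    show "inf x y \<le> x" "inf x y \<le> y" unfolding less_eq_free_alg_def using ia ic ii by metis+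
    show "x \<le> y \<Longrightarrow> x \<le> z \<Longrightarrow> x \<le> inf y z" unfolding less_eq_free_alg_def using ia by metis
    show "x \<le> sup x y" "y \<le> sup x y" unfolding less_eq_free_alg_def using iab sc by metis+
    show "y \<le> x \<Longrightarrow> z \<le> x \<Longrightarrow> sup y z \<le> x" unfolding le_sup using sa by metis
    show "x \<le> top" by (simp add: less_eq_free_alg_def it)
    have "inf (inf x (- x)) x = inf x (- x)" using ia ic ii by metis
    then show "bot \<le> x" by (simp add: less_eq_free_alg_def inn)
    show "sup x (inf y z) = inf (sup x y) (sup x z)" by (rule dist)
    show "inf x (- x) = bot" by (rule inn)
    show "sup x (- x) = top" by (rule sn)
    show "x - y = inf x (- y)" by (rule minus_free_alg_def)
  qed
qed

end

abbreviation gen :: "'a::boolean_algebra \<Rightarrow> 'a \<Rightarrow> 'a free_alg" where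
  "gen a b \<equiv> abs_free_alg (Basic (a, b))"


subsection \<open>The Boolean algebra of conditionals\<close>

inductive cond_cong :: "'a::boolean_algebra free_alg \<Rightarrow> 'a free_alg \<Rightarrow> bool" where
  refl: "cond_cong x x"
| sym: "cond_cong x y \<Longrightarrow> cond_cong y x"
| trans: "cond_cong x y \<Longrightarrow> cond_cong y z \<Longrightarrow> cond_cong x z"
| cong_uminus: "cond_cong x y \<Longrightarrow> cond_cong (- x) (- y)"
| cong_inf: "cond_cong x x' \<Longrightarrow> cond_cong y y' \<Longrightarrow> cond_cong (inf x y) (inf x' y')"
| cong_sup: "cond_cong x x' \<Longrightarrow> cond_cong y y' \<Longrightarrow> cond_cong (sup x y) (sup x' y')"
| cond_self: "b \<noteq> bot \<Longrightarrow> cond_cong (gen b b) top"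
| cond_inf: "b \<noteq> bot \<Longrightarrow> cond_cong (inf (gen a\<^sub>1 b) (gen a\<^sub>2 b)) (gen (inf a\<^sub>1 a\<^sub>2) b)"
| cond_uminus: "b \<noteq> bot \<Longrightarrow> cond_cong (- gen a b) (gen (- a) b)"
| cond_restrict: "b \<noteq> bot \<Longrightarrow> cond_cong (gen (inf a b) b) (gen a b)"
| cond_chain: "b \<noteq> bot \<Longrightarrow> c \<noteq> bot \<Longrightarrow> a \<le> b \<Longrightarrow> b \<le> c \<Longrightarrow>
    cond_cong (inf (gen a b) (gen b c)) (gen a c)"

quotient_type (overloaded) 'a cond_alg = "'a::boolean_algebra free_alg" / cond_cong
proof (rule equivpI)
  show "reflp (cond_cong :: 'a free_alg \<Rightarrow> _)" by (rule reflpI) (rule cond_cong.refl)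
  show "symp (cond_cong :: 'a free_alg \<Rightarrow> _)" by (rule sympI) (rule cond_cong.sym)
  show "transp (cond_cong :: 'a free_alg \<Rightarrow> _)" by (rule transpI) (rule cond_cong.trans)
qed

instantiation cond_alg :: (boolean_algebra) boolean_algebra
begin

lift_definition inf_cond_alg :: "'a cond_alg \<Rightarrow> 'a cond_alg \<Rightarrow> 'a cond_alg" is inf
  by (rule cond_cong.cong_inf)
lift_definition sup_cond_alg :: "'a cond_alg \<Rightarrow> 'a cond_alg \<Rightarrow> 'a cond_alg" is sup
  by (rule cond_cong.cong_sup)
lift_definition uminus_cond_alg :: "'a cond_alg \<Rightarrow> 'a cond_alg" is uminus
  by (rule cond_cong.cong_uminus)
lift_definition top_cond_alg :: "'a cond_alg" is top .
lift_definition bot_cond_alg :: "'a cond_alg" is bot .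
definition minus_cond_alg :: "'a cond_alg \<Rightarrow> 'a cond_alg \<Rightarrow> 'a cond_alg" where
  "minus_cond_alg x y = inf x (- y)"
definition less_eq_cond_alg :: "'a cond_alg \<Rightarrow> 'a cond_alg \<Rightarrow> bool" where
  "less_eq_cond_alg x y \<longleftrightarrow> inf x y = x"
definition less_cond_alg :: "'a cond_alg \<Rightarrow> 'a cond_alg \<Rightarrow> bool" where
  "less_cond_alg x y \<longleftrightarrow> x \<le> y \<and> \<not> y \<le> x"

instance
proof -
  have R: "cond_cong x y" if "x = y" for x y :: "'a free_alg"
    using that by (simp add: cond_cong.refl)
  have ia: "inf (inf x y) z = inf x (inf y z)" for x y z :: "'a cond_alg"
    by transfer (rule R, simp add: inf.assoc)
  have sa: "sup (sup x y) z = sup x (sup y z)" for x y z :: "'a cond_alg"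
    by transfer (rule R, simp add: sup.assoc)
  have ic: "inf x y = inf y x" for x y :: "'a cond_alg"
    by transfer (rule R, simp add: inf.commute)
  have sc: "sup x y = sup y x" for x y :: "'a cond_alg"
    by transfer (rule R, simp add: sup.commute)
  have iab: "inf x (sup x y) = x" for x y :: "'a cond_alg"
    by transfer (rule R, simp)
  have sab: "sup x (inf x y) = x" for x y :: "'a cond_alg"
    by transfer (rule R, simp)
  have dist: "sup x (inf y z) = inf (sup x y) (sup x z)" for x y z :: "'a cond_alg"
    by transfer (rule R, simp add: sup_inf_distrib1)
  have it: "inf x top = x" for x :: "'a cond_alg"
    by transfer (rule R, simp)
  have sn: "sup x (- x) = top" for x :: "'a cond_alg"
    by transfer (rule R, simp)
  have inn: "inf x (- x) = bot" for x :: "'a cond_alg"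
    by transfer (rule R, simp)
  have ii: "inf x x = x" for x :: "'a cond_alg" using iab sab by metis
  have le_sup: "x \<le> y \<longleftrightarrow> sup x y = y" for x y :: "'a cond_alg"
    unfolding less_eq_cond_alg_def using iab sab ic sc by metis
  show "OFCLASS('a cond_alg, boolean_algebra_class)"
  proof
    fix x y z :: "'a cond_alg"
    show "(x < y) = (x \<le> y \<and> \<not> y \<le> x)" by (rule less_cond_alg_def)
    show "x \<le> x" by (simp add: less_eq_cond_alg_def ii)
    show "x \<le> y \<Longrightarrow> y \<le> z \<Longrightarrow> x \<le> z" unfolding less_eq_cond_alg_def using ia by metis
    show "x \<le> y \<Longrightarrow> y \<le> x \<Longrightarrow> x = y" unfolding less_eq_cond_alg_def using ic by metis
    show "inf x y \<le> x" "inf x y \<le> y" unfolding less_eq_cond_alg_def using ia ic ii by metis+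
    show "x \<le> y \<Longrightarrow> x \<le> z \<Longrightarrow> x \<le> inf y z" unfolding less_eq_cond_alg_def using ia by metis
    show "x \<le> sup x y" "y \<le> sup x y" unfolding less_eq_cond_alg_def using iab sc by metis+
    show "y \<le> x \<Longrightarrow> z \<le> x \<Longrightarrow> sup y z \<le> x" unfolding le_sup using sa by metis
    show "x \<le> top" by (simp add: less_eq_cond_alg_def it)
    have "inf (inf x (- x)) x = inf x (- x)" using ia ic ii by metis
    then show "bot \<le> x" by (simp add: less_eq_cond_alg_def inn)
    show "sup x (inf y z) = inf (sup x y) (sup x z)" by (rule dist)
    show "inf x (- x) = bot" by (rule inn)
    show "sup x (- x) = top" by (rule sn)
    show "x - y = inf x (- y)" by (rule minus_cond_alg_def)
  qed
qed

end

definition cond_class :: "'a::boolean_algebra cond_term \<Rightarrow> 'a cond_alg" where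
  "cond_class t = abs_cond_alg (abs_free_alg t)"

lemma cond_class_simps:
  fixes s t :: "'a::boolean_algebra cond_term"
  shows "cond_class One = (top :: 'a cond_alg)" "cond_class Zero = (- top :: 'a cond_alg)"
  "t \<in> cond_terms \<Longrightarrow> cond_class (Neg t) = - cond_class t"
  "s \<in> cond_terms \<Longrightarrow> t \<in> cond_terms \<Longrightarrow>
     cond_class (Conj s t) = inf (cond_class s) (cond_class t)"
  "s \<in> cond_terms \<Longrightarrow> t \<in> cond_terms \<Longrightarrow>
     cond_class (Disj s t) = sup (cond_class s) (cond_class t)"
proof -
  note T = free_eq_refl_iff
  show "cond_class One = (top :: 'a cond_alg)"
    by (simp add: cond_class_def top_cond_alg.abs_eq top_free_alg.abs_eq)
  have "abs_free_alg Zero = (abs_free_alg (Neg One) :: 'a free_alg)"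
    using Quotient3_rel_abs[OF Quotient3_free_alg] free_eq.Zero_eq by blast
  then show "cond_class Zero = (- top :: 'a cond_alg)"
    by (simp add: cond_class_def bot_cond_alg.abs_eq bot_free_alg.abs_eq)
  show "t \<in> cond_terms \<Longrightarrow> cond_class (Neg t) = - cond_class t"
    by (simp add: cond_class_def uminus_cond_alg.abs_eq uminus_free_alg.abs_eq T eq_onp_def)
  show "s \<in> cond_terms \<Longrightarrow> t \<in> cond_terms \<Longrightarrow>
     cond_class (Conj s t) = inf (cond_class s) (cond_class t)"
    by (simp add: cond_class_def inf_cond_alg.abs_eq inf_free_alg.abs_eq T eq_onp_def)
  show "s \<in> cond_terms \<Longrightarrow> t \<in> cond_terms \<Longrightarrow>
     cond_class (Disj s t) = sup (cond_class s) (cond_class t)"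
    by (simp add: cond_class_def sup_cond_alg.abs_eq sup_free_alg.abs_eq T eq_onp_def)
qed


subsection \<open>The canonical extension of a probability\<close>

definition atom_seqs :: "'a::{finite,boolean_algebra} list set" where
  "atom_seqs = {\<beta>. distinct \<beta> \<and> set \<beta> \<subseteq> Collect is_atom \<and>
     length \<beta> = card {a::'a. is_atom a} - 1}"

text \<open>In \<open>omega\<close> and \<open>omega_value\<close> the first argument accumulates the antecedent
  \<open>\<not>\<beta>\<^sub>1 \<and> \<dots> \<and> \<not>\<beta>\<^sub>i\<close> and starts with \<open>top\<close>. The empty sequence only matters for the algebra
  with a single atom.\<close>

fun omega :: "'a::boolean_algebra \<Rightarrow> 'a list \<Rightarrow> 'a cond_term" where
  "omega c [] = One"
| "omega c [\<beta>] = Basic (\<beta>, c)"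
| "omega c (\<beta> # \<gamma> # \<beta>s) = Conj (Basic (\<beta>, c)) (omega (inf c (- \<beta>)) (\<gamma> # \<beta>s))"

fun omega_value :: "('a::boolean_algebra \<Rightarrow> real) \<Rightarrow> 'a \<Rightarrow> 'a list \<Rightarrow> real" where
  "omega_value P c [] = 1"
| "omega_value P c (\<beta> # \<beta>s) = cond_prob P \<beta> c * omega_value P (inf c (- \<beta>)) \<beta>s"

definition mu :: "('a::{finite,boolean_algebra} \<Rightarrow> real) \<Rightarrow> 'a cond_alg \<Rightarrow> real" where
  "mu P = (THE \<mu>. probability \<mu> \<and>
     (\<forall>\<beta>\<in>atom_seqs. \<mu> (cond_class (omega top \<beta>)) = omega_value P top \<beta>))"

end

theory Submission
  imports Defs "HOL-Combinatorics.Multiset_Permutations"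
begin

text \<open>
  Draw the atoms of \<open>A\<close> one after the other without replacement, each with its probability
  conditional on not having been drawn before. A conditional \<open>(a | b)\<close> is true along the resulting
  ordering iff the first atom drawn below \<open>b\<close> lies below \<open>a\<close>; this makes every ordering a
  homomorphism from \<open>\<C>(A)\<close> to the truth values, and the orderings correspond to the atoms
  \<open>\<omega>\<^sub>\<beta>\<close>. Hence \<open>\<mu>\<^sub>P\<close> of a class is the probability that a representing term is true
  along a random ordering.

  On the other hand, the order in which the atoms below \<open>b\<close> are drawn is distributed as if only
  these atoms were present. Taking for \<open>b\<close> the disjunction of the antecedents of \<open>t\<close> and
  conditioning on the first drawn atom \<open>w\<close> below \<open>b\<close> turns \<open>t\<close> into its reduct \<open>t\<^sup>w\<close>, so the
  probability of truth satisfies the recursion that defines \<open>P\<^sup>*\<close>.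
\<close>

section \<open>Atoms and finitely additive functions\<close>

definition atoms_below :: "'a::boolean_algebra \<Rightarrow> 'a set" where
  "atoms_below c = {x. is_atom x \<and> x \<le> c}"

lemma is_atom_le_uminus: "is_atom x \<Longrightarrow> x \<le> - a \<longleftrightarrow> \<not> x \<le> a"
  unfolding is_atom_def by (metis inf.absorb_iff1 inf.cobounded1 inf_shunt)

lemma is_atom_le_sup: "is_atom x \<Longrightarrow> x \<le> sup a b \<longleftrightarrow> x \<le> a \<or> x \<le> b"
  using is_atom_le_uminus[of x] by (metis compl_sup double_compl le_inf_iff)

lemma is_atom_le_atom: "is_atom x \<Longrightarrow> is_atom y \<Longrightarrow> x \<le> y \<longleftrightarrow> x = y"
  unfolding is_atom_def by blast

lemma le_uminus_is_atom: "is_atom x \<Longrightarrow> b \<le> - x \<longleftrightarrow> \<not> x \<le> b"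
  using is_atom_le_uminus compl_le_swap1 by blast

lemma ex_atom_below:
  fixes b :: "'a::{finite,boolean_algebra}"
  assumes "b \<noteq> bot"
  shows "\<exists>x. is_atom x \<and> x \<le> b"
proof -
  have "finite {a. a \<noteq> bot \<and> a \<le> b}" "{a. a \<noteq> bot \<and> a \<le> b} \<noteq> {}"
    using assms by auto
  from finite_has_minimal[OF this] obtain m where
    m: "m \<noteq> bot" "m \<le> b" "\<And>a. a \<noteq> bot \<Longrightarrow> a \<le> b \<Longrightarrow> a \<le> m \<Longrightarrow> m = a"
    by auto
  then have "is_atom m"
    unfolding is_atom_def by (metis order_trans)
  with m show ?thesis by blast
qed

lemma atoms_below_bot [simp]: "atoms_below bot = {}"
  by (auto simp: atoms_below_def is_atom_def bot_unique)

lemma atoms_below_empty_iff: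
  "atoms_below c = {} \<longleftrightarrow> c = (bot :: 'a::{finite,boolean_algebra})"
  using ex_atom_below[of c] by (auto simp: atoms_below_def is_atom_def bot_unique)

lemma atoms_below_remove:
  "x \<in> atoms_below c \<Longrightarrow> atoms_below (inf c (- x)) = atoms_below c - {x}"
  by (auto simp: atoms_below_def is_atom_le_uminus is_atom_le_atom)

lemma sum_atoms_below_split:
  fixes c :: "'a::{finite,boolean_algebra}"
  assumes "b \<le> c"
  shows "(\<Sum>x\<in>atoms_below c. g x) =
    (\<Sum>x\<in>atoms_below b. g x) + (\<Sum>x\<in>atoms_below (inf c (- b)). g x)"
proof -
  have "atoms_below c = atoms_below b \<union> atoms_below (inf c (- b))"
    "atoms_below b \<inter> atoms_below (inf c (- b)) = {}"
    using assms by (auto simp: atoms_below_def is_atom_le_uminus)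
  then show ?thesis by (simp add: sum.union_disjoint)
qed

lemma remove_atom_induct [case_names bot remove]:
  fixes c :: "'a::{finite,boolean_algebra}"
  assumes "Q bot"
    and "\<And>c. c \<noteq> bot \<Longrightarrow> (\<And>x. x \<in> atoms_below c \<Longrightarrow> Q (inf c (- x))) \<Longrightarrow> Q c"
  shows "Q c"
proof (induction "card (atoms_below c)" arbitrary: c rule: less_induct)
  case less
  show ?case
  proof (cases "c = bot")
    case False
    show ?thesis
    proof (rule assms(2)[OF False])
      fix x assume "x \<in> atoms_below c"
      then have "card (atoms_below (inf c (- x))) < card (atoms_below c)"
        by (simp only: atoms_below_remove card_Diff1_less finite)
      then show "Q (inf c (- x))" by (rule less)
    qed
  qed (simp add: assms(1))
qed

definition finitely_additive ::
  "('a::boolean_algebra \<Rightarrow> 'b::cancel_comm_monoid_add) \<Rightarrow> bool" where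
  "finitely_additive g \<longleftrightarrow> (\<forall>a b. inf a b = bot \<longrightarrow> g (sup a b) = g a + g b)"

lemma finitely_additiveD:
  "finitely_additive g \<Longrightarrow> inf a b = bot \<Longrightarrow> g (sup a b) = g a + g b"
  by (simp add: finitely_additive_def)

lemma finitely_additive_bot: "finitely_additive g \<Longrightarrow> g bot = 0"
  using finitely_additiveD[of g bot bot] by simp

lemma finitely_additive_split:
  assumes "finitely_additive g" "b \<le> c"
  shows "g c = g b + g (inf c (- b))"
  using finitely_additiveD[OF assms(1), of b "inf c (- b)"] assms(2)
  by (simp add: inf_left_commute sup_inf_distrib1 sup_absorb2)

lemma finitely_additive_eq_sum_atoms:
  fixes c :: "'a::{finite,boolean_algebra}"
  assumes "finitely_additive g"
  shows "g c = (\<Sum>x\<in>atoms_below c. g x)"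
proof (induction c rule: remove_atom_induct)
  case bot
  show ?case by (simp add: finitely_additive_bot assms)
next
  case (remove c)
  then obtain x where x: "x \<in> atoms_below c"
    using atoms_below_empty_iff by blast
  then have "g c = g x + g (inf c (- x))"
    by (intro finitely_additive_split assms) (simp add: atoms_below_def)
  also have "g (inf c (- x)) = (\<Sum>y\<in>atoms_below c - {x}. g y)"
    using remove.IH[OF x] by (simp add: atoms_below_remove x)
  finally show ?case using x by (simp add: sum.remove[of _ x])
qed

lemma probability_finitely_additive: "probability P \<Longrightarrow> finitely_additive P"
  by (simp add: probability_def finitely_additive_def)

lemma probability_top_neq_bot:
  fixes P :: "'a::boolean_algebra \<Rightarrow> real"
  assumes "probability P"
  shows "(top :: 'a) \<noteq> bot"
  using finitely_additive_bot[OF probability_finitely_additive[OF assms]] assms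
  by (auto simp: probability_def)

lemma positive_neq_0: "positive P \<Longrightarrow> b \<noteq> bot \<Longrightarrow> P b \<noteq> 0"
  by (auto simp: positive_def dest: spec[of _ b])

lemma finitely_additive_cond_prob:
  assumes "probability P"
  shows "finitely_additive (\<lambda>a. cond_prob P a c)"
  unfolding finitely_additive_def
proof (intro allI impI)
  fix a b :: 'a
  assume "inf a b = bot"
  moreover have "inf (inf a c) (inf b c) = inf (inf a b) c" by (simp add: inf_aci)
  ultimately have "inf (inf a c) (inf b c) = bot" by simp
  then show "cond_prob P (sup a b) c = cond_prob P a c + cond_prob P b c"
    using finitely_additiveD[OF probability_finitely_additive[OF assms]]
    by (simp add: cond_prob_def inf_sup_distrib2 add_divide_distrib)
qed

lemma cond_prob_self: "P c \<noteq> 0 \<Longrightarrow> cond_prob P c c = 1"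
  by (simp add: cond_prob_def)

lemma cond_prob_chain:
  assumes "a \<le> b" "b \<le> c" "P b \<noteq> 0"
  shows "cond_prob P a c = cond_prob P b c * cond_prob P a b"
  using assms order_trans[OF assms(1,2)] by (simp add: cond_prob_def inf_absorb1)

lemma sum_cond_prob_atoms:
  fixes P :: "'a::{finite,boolean_algebra} \<Rightarrow> real"
  assumes "probability P"
  shows "(\<Sum>x\<in>atoms_below b. cond_prob P x c) = cond_prob P b c"
  by (rule finitely_additive_eq_sum_atoms[OF finitely_additive_cond_prob[OF assms], symmetric])

lemma world_iff_atom_of:
  fixes w :: "'a::{finite,boolean_algebra} \<Rightarrow> bool"
  assumes "w \<in> worlds"
  shows "w a \<longleftrightarrow> atom_of w \<le> a"
proof -
  have hom: "w (- a) = (\<not> w a)" "\<And>a b. w (inf a b) = (w a \<and> w b)"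
    using assms by (auto simp: worlds_def)
  have atom: "is_atom (atom_of w)" "w (atom_of w)" using atom_of_world[OF assms] by auto
  have up: "w b" if "atom_of w \<le> b" for b
    using hom(2)[of "atom_of w" b] atom(2) that by (simp add: inf_absorb1)
  show ?thesis
    using up[of a] up[of "- a"] hom(1) is_atom_le_uminus[OF atom(1)] by blast
qed

lemma principal_world:
  assumes "is_atom x"
  shows "(\<lambda>a. x \<le> a) \<in> worlds"
  using assms is_atom_le_uminus[OF assms] is_atom_le_sup[OF assms]
  by (auto simp: worlds_def is_atom_def bot_unique)

lemma atom_of_principal:
  assumes "is_atom x"
  shows "atom_of (\<lambda>a. x \<le> a) = x"
  unfolding atom_of_def
  by (rule the_equality) (use assms in \<open>auto simp: is_atom_le_atom\<close>)

lemma bij_betw_atom_of: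
  fixes b :: "'a::{finite,boolean_algebra}"
  shows "bij_betw atom_of {w \<in> worlds. w b} (atoms_below b)"
proof (rule bij_betw_byWitness[where f' = "\<lambda>x a. x \<le> a"])
  show "\<forall>w\<in>{w \<in> worlds. w b}. (\<lambda>a. atom_of w \<le> a) = w"
    by (auto simp: fun_eq_iff world_iff_atom_of)
  show "atom_of ` {w \<in> worlds. w b} \<subseteq> atoms_below b"
    using atom_of_world world_iff_atom_of by (auto simp: atoms_below_def)
qed (auto simp: atoms_below_def atom_of_principal principal_world)

lemma expect_eq_sum_atoms:
  fixes P :: "'a::{finite,boolean_algebra} \<Rightarrow> real"
  assumes "probability P"
  shows "expect P X b = (\<Sum>x\<in>atoms_below b. X (\<lambda>a. x \<le> a) * cond_prob P x b)"
proof -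
  have "expect P X b = (\<Sum>w | w \<in> worlds \<and> w b. X w * cond_prob P (atom_of w) b)"
    unfolding expect_def
    by (rule sum.mono_neutral_right) (auto simp: cond_prob_outside assms)
  also have "\<dots> = (\<Sum>w | w \<in> worlds \<and> w b.
      X (\<lambda>a. atom_of w \<le> a) * cond_prob P (atom_of w) b)"
  proof (rule sum.cong)
    fix w assume "w \<in> {w \<in> worlds. w b}"
    then have "w = (\<lambda>a. atom_of w \<le> a)" by (auto simp: fun_eq_iff world_iff_atom_of)
    then show "X w * cond_prob P (atom_of w) b =
        X (\<lambda>a. atom_of w \<le> a) * cond_prob P (atom_of w) b" by simp
  qed simp
  also have "\<dots> = (\<Sum>x\<in>atoms_below b. X (\<lambda>a. x \<le> a) * cond_prob P x b)"
    by (rule sum.reindex_bij_betw[OF bij_betw_atom_of])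
  finally show ?thesis .
qed

lemma expect_cong:
  fixes P :: "'a::{finite,boolean_algebra} \<Rightarrow> real"
  assumes "probability P" "\<And>w. w \<in> worlds \<Longrightarrow> w b \<Longrightarrow> X w = Y w"
  shows "expect P X b = expect P Y b"
  unfolding expect_eq_sum_atoms[OF assms(1)]
  by (rule sum.cong) (auto simp: atoms_below_def intro: assms(2) principal_world)

lemma expect_const:
  fixes P :: "'a::{finite,boolean_algebra} \<Rightarrow> real"
  assumes "probability P" "P b \<noteq> 0"
  shows "expect P (\<lambda>_. r) b = r"
  using assms
  by (simp add: expect_eq_sum_atoms sum_distrib_left[symmetric] sum_cond_prob_atoms cond_prob_self)


section \<open>Random orderings of the atoms\<close>

abbreviation orderings :: "'a::{finite,boolean_algebra} \<Rightarrow> 'a list set" where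
  "orderings c \<equiv> permutations_of_set (atoms_below c)"

lemma Nil_in_orderings_iff: "[] \<in> orderings c \<longleftrightarrow> c = bot"
  using atoms_below_empty_iff[of c] by (auto simp: permutations_of_set_def)

lemma Cons_in_orderings_iff:
  "x # \<beta> \<in> orderings c \<longleftrightarrow> x \<in> atoms_below c \<and> \<beta> \<in> orderings (inf c (- x))"
  by (cases "x \<in> atoms_below c") (auto simp: permutations_of_set_def atoms_below_remove)

lemma ordering_induct [consumes 1, case_names Nil Cons]:
  fixes c :: "'a::{finite,boolean_algebra}"
  assumes "\<beta> \<in> orderings c" "Q bot []"
    and "\<And>c x \<beta>. c \<noteq> bot \<Longrightarrow> x \<in> atoms_below c \<Longrightarrow> \<beta> \<in> orderings (inf c (- x)) \<Longrightarrow>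
      Q (inf c (- x)) \<beta> \<Longrightarrow> Q c (x # \<beta>)"
  shows "Q c \<beta>"
  using assms(1)
proof (induction \<beta> arbitrary: c)
  case Nil
  with assms(2) show ?case by (simp add: Nil_in_orderings_iff)
next
  case (Cons x \<beta>)
  then show ?case by (intro assms(3)) (auto simp: Cons_in_orderings_iff)
qed

lemma sum_orderings:
  fixes f :: "'a::{finite,boolean_algebra} list \<Rightarrow> 'b::comm_monoid_add"
  assumes "c \<noteq> bot"
  shows "(\<Sum>\<beta>\<in>orderings c. f \<beta>) =
    (\<Sum>x\<in>atoms_below c. \<Sum>\<beta>\<in>orderings (inf c (- x)). f (x # \<beta>))"
proof -
  have "orderings c = (\<Union>x\<in>atoms_below c. (#) x ` orderings (inf c (- x)))"
    using assms by (simp add: permutations_of_set_nonempty atoms_below_empty_iff atoms_below_remove)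
  then have "(\<Sum>\<beta>\<in>orderings c. f \<beta>) =
      (\<Sum>x\<in>atoms_below c. \<Sum>\<beta>\<in>(#) x ` orderings (inf c (- x)). f \<beta>)"
    by (simp only:) (rule sum.UNION_disjoint, auto)
  then show ?thesis by (simp add: sum.reindex)
qed

lemma filter_Cons_ordering:
  assumes "\<beta> \<in> orderings (inf c (- x))" "x \<le> b"
  shows "filter (\<lambda>y. y \<le> b) (x # \<beta>) = x # filter (\<lambda>y. y \<le> inf b (- x)) \<beta>"
  using assms by (auto simp: atoms_below_def dest: permutations_of_setD(1) intro!: filter_cong)

definition ordering_expect ::
  "('a::{finite,boolean_algebra} \<Rightarrow> real) \<Rightarrow> 'a \<Rightarrow> ('a list \<Rightarrow> real) \<Rightarrow> real" where
  "ordering_expect P c f = (\<Sum>\<beta>\<in>orderings c. omega_value P c \<beta> * f \<beta>)"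

lemma ordering_expect_bot [simp]: "ordering_expect P bot f = f []"
  by (simp add: ordering_expect_def)

lemma ordering_expect_rec:
  assumes "c \<noteq> bot"
  shows "ordering_expect P c f =
    (\<Sum>x\<in>atoms_below c. cond_prob P x c * ordering_expect P (inf c (- x)) (\<lambda>\<beta>. f (x # \<beta>)))"
  using assms by (simp add: ordering_expect_def sum_orderings sum_distrib_left mult.assoc)

lemma ordering_expect_cong:
  "(\<And>\<beta>. \<beta> \<in> orderings c \<Longrightarrow> f \<beta> = g \<beta>) \<Longrightarrow> ordering_expect P c f = ordering_expect P c g"
  by (simp add: ordering_expect_def)

lemma ordering_expect_first_below:
  fixes P :: "'a::{finite,boolean_algebra} \<Rightarrow> real"
  assumes "probability P" "positive P" "b \<le> c"
  shows "(\<Sum>x\<in>atoms_below b. cond_prob P x c *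
      ordering_expect P (inf b (- x)) (\<lambda>\<beta>. f (x # \<beta>))) =
    cond_prob P b c * ordering_expect P b f"
proof (cases "b = bot")
  case True
  then show ?thesis
    by (simp add: finitely_additive_bot[OF finitely_additive_cond_prob[OF assms(1)]])
next
  case False
  have "cond_prob P x c = cond_prob P b c * cond_prob P x b" if "x \<in> atoms_below b" for x
    using that assms(3) positive_neq_0[OF assms(2) False]
    by (intro cond_prob_chain) (auto simp: atoms_below_def)
  then show ?thesis
    by (simp add: ordering_expect_rec[OF False] sum_distrib_left mult.assoc)
qed

text \<open>The first draw from \<open>c\<close> lies below \<open>b\<close> with probability \<open>P(b | c)\<close>, and given this it has
  the law of the first draw from \<open>b\<close>; the hypotheses on \<open>h\<close> say that a draw outside \<open>b\<close> is
  ignored.\<close>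

lemma sum_first_draw_restrict:
  fixes P :: "'a::{finite,boolean_algebra} \<Rightarrow> real"
  assumes P: "probability P" "positive P" and "c \<noteq> bot" "b \<le> c"
    and below: "\<And>x. x \<in> atoms_below b \<Longrightarrow>
      h x = ordering_expect P (inf b (- x)) (\<lambda>\<beta>. f (x # \<beta>))"
    and outside: "\<And>x. x \<in> atoms_below (inf c (- b)) \<Longrightarrow> h x = ordering_expect P b f"
  shows "(\<Sum>x\<in>atoms_below c. cond_prob P x c * h x) = ordering_expect P b f"
proof -
  have "(\<Sum>x\<in>atoms_below c. cond_prob P x c * h x) =
      (\<Sum>x\<in>atoms_below b. cond_prob P x c *
        ordering_expect P (inf b (- x)) (\<lambda>\<beta>. f (x # \<beta>))) +
      (\<Sum>x\<in>atoms_below (inf c (- b)). cond_prob P x c * ordering_expect P b f)"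
    by (simp only: sum_atoms_below_split[OF \<open>b \<le> c\<close>] below outside cong: sum.cong)
  also have "\<dots> = (cond_prob P b c + cond_prob P (inf c (- b)) c) * ordering_expect P b f"
    by (simp only: ordering_expect_first_below[OF P \<open>b \<le> c\<close>] sum_distrib_right[symmetric]
        sum_cond_prob_atoms[OF P(1)] distrib_right)
  also have "cond_prob P b c + cond_prob P (inf c (- b)) c = cond_prob P c c"
    by (rule finitely_additive_split[OF finitely_additive_cond_prob[OF P(1)] \<open>b \<le> c\<close>, symmetric])
  also have "\<dots> = 1"
    by (rule cond_prob_self) (rule positive_neq_0[OF P(2) \<open>c \<noteq> bot\<close>])
  finally show ?thesis by simp
qed

lemma ordering_expect_filter:
  fixes P :: "'a::{finite,boolean_algebra} \<Rightarrow> real"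
  assumes P: "probability P" "positive P" and "b \<le> c"
  shows "ordering_expect P c (\<lambda>\<beta>. f (filter (\<lambda>x. x \<le> b) \<beta>)) = ordering_expect P b f"
  using \<open>b \<le> c\<close>
proof (induction c arbitrary: b f rule: remove_atom_induct)
  case bot
  then show ?case by (simp add: bot_unique)
next
  case (remove c)
  let ?E = "\<lambda>x. ordering_expect P (inf c (- x)) (\<lambda>\<beta>. f (filter (\<lambda>y. y \<le> b) (x # \<beta>)))"
  have below: "?E x = ordering_expect P (inf b (- x)) (\<lambda>\<beta>. f (x # \<beta>))"
    if x: "x \<in> atoms_below b" for x
  proof -
    have "?E x = ordering_expect P (inf c (- x))
        (\<lambda>\<beta>. f (x # filter (\<lambda>y. y \<le> inf b (- x)) \<beta>))"
      using x by (intro ordering_expect_cong)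
        (simp only: filter_Cons_ordering atoms_below_def mem_Collect_eq)
    also have "\<dots> = ordering_expect P (inf b (- x)) (\<lambda>\<beta>. f (x # \<beta>))"
      using x remove.prems
      by (intro remove.IH[of x _ "\<lambda>\<beta>. f (x # \<beta>)"]) (auto simp: atoms_below_def intro: le_infI1)
    finally show ?thesis .
  qed
  have outside: "?E x = ordering_expect P b f" if x: "x \<in> atoms_below (inf c (- b))" for x
  proof -
    have "x \<in> atoms_below c" "\<not> x \<le> b" "b \<le> - x"
      using x by (auto simp: atoms_below_def is_atom_le_uminus le_uminus_is_atom)
    then show ?thesis using remove by simp
  qed
  have "ordering_expect P c (\<lambda>\<beta>. f (filter (\<lambda>x. x \<le> b) \<beta>)) =
      (\<Sum>x\<in>atoms_below c. cond_prob P x c * ?E x)"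
    by (rule ordering_expect_rec[OF remove.hyps])
  also have "\<dots> = ordering_expect P b f"
    by (rule sum_first_draw_restrict[OF P remove.hyps remove.prems below outside])
  finally show ?case .
qed

lemma ordering_expect_const:
  fixes P :: "'a::{finite,boolean_algebra} \<Rightarrow> real"
  assumes "probability P" "positive P"
  shows "ordering_expect P c (\<lambda>_. r) = r"
  using ordering_expect_filter[OF assms bot_least, of c "\<lambda>_. r"] by simp


section \<open>Truth of a term along an ordering\<close>

primrec term_eval :: "('c \<Rightarrow> 'b::boolean_algebra) \<Rightarrow> 'c bterm \<Rightarrow> 'b" where
  "term_eval v (Basic c) = v c"
| "term_eval v Zero = bot"
| "term_eval v One = top"
| "term_eval v (Neg t) = - term_eval v t"
| "term_eval v (Conj s t) = inf (term_eval v s) (term_eval v t)"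
| "term_eval v (Disj s t) = sup (term_eval v s) (term_eval v t)"

fun cond_holds :: "'a::boolean_algebra list \<Rightarrow> 'a \<times> 'a \<Rightarrow> bool" where
  "cond_holds [] c = False"
| "cond_holds (x # \<beta>) c = (if x \<le> snd c then x \<le> fst c else cond_holds \<beta> c)"

lemma term_eval_cong:
  "(\<And>c. c \<in> basics t \<Longrightarrow> v c = v' c) \<Longrightarrow> term_eval v t = term_eval v' t"
  by (induction t) auto

lemma term_eval_nf: "term_eval v (nf t) = term_eval v t"
  by (induction t) (auto split: if_splits)

lemma term_eval_reduct:
  assumes "is_atom x"
  shows "term_eval (cond_holds \<beta>) (reduct (\<lambda>a. x \<le> a) t) = term_eval (cond_holds (x # \<beta>)) t"
  unfolding reduct_eq_nf term_eval_nf
  by (induction t) (auto simp: is_atom_le_uminus[OF assms])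

lemma cond_holds_filter:
  "snd c \<le> b \<Longrightarrow> cond_holds (filter (\<lambda>x. x \<le> b) \<beta>) c = cond_holds \<beta> c"
  by (induction \<beta>) auto

lemma basics_nf: "basics (nf t) \<subseteq> basics t"
  by (induction t) auto

lemma basics_world_subst:
  assumes "w \<in> worlds"
  shows "basics (world_subst w t) \<subseteq> {(a, b) \<in> basics t. \<not> w b}"
  using assms by (induction t) (auto simp: worlds_def)

lemma basics_reduct:
  assumes "w \<in> worlds"
  shows "basics (reduct w t) \<subseteq> {(a, b) \<in> basics t. \<not> w b}"
  unfolding reduct_eq_nf by (rule subset_trans[OF basics_nf basics_world_subst[OF assms]])

lemma reduct_cond_terms: "w \<in> worlds \<Longrightarrow> t \<in> cond_terms \<Longrightarrow> reduct w t \<in> cond_terms"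
  using basics_reduct[of w t] by (auto simp: cond_terms_def)

lemma basics_le_antecedent:
  assumes "(a, b) \<in> basics t"
  shows "b \<le> antecedent t"
proof -
  have "finite (basics t)" by (induction t) auto
  with assms show ?thesis
    unfolding antecedent_def by (auto intro!: Sup_fin.coboundedI image_eqI[of _ snd])
qed

lemma antecedent_neq_bot:
  fixes t :: "'a::boolean_algebra cond_term"
  assumes "t \<in> cond_terms" "(top :: 'a) \<noteq> bot"
  shows "antecedent t \<noteq> bot"
proof (cases "basics t = {}")
  case False
  then obtain a b where ab: "(a, b) \<in> basics t" by fastforce
  then have "b \<noteq> bot" using assms by (auto simp: cond_terms_def)
  then show ?thesis using basics_le_antecedent[OF ab] by (metis bot_unique)
qed (use assms in \<open>simp add: antecedent_def\<close>)

lemma basics_reduct_le: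
  assumes "is_atom x" "(a, b) \<in> basics (reduct (\<lambda>a. x \<le> a) t)"
  shows "b \<le> inf (antecedent t) (- x)"
proof -
  have "(a, b) \<in> basics t" "\<not> x \<le> b"
    using assms(2) basics_reduct[OF principal_world[OF assms(1)], of t] by auto
  then show ?thesis by (simp add: basics_le_antecedent le_uminus_is_atom assms(1))
qed

definition truth_prob ::
  "('a::{finite,boolean_algebra} \<Rightarrow> real) \<Rightarrow> 'a \<Rightarrow> 'a cond_term \<Rightarrow> real" where
  "truth_prob P c t = ordering_expect P c (\<lambda>\<beta>. of_bool (term_eval (cond_holds \<beta>) t))"

lemma truth_prob_restrict:
  fixes P :: "'a::{finite,boolean_algebra} \<Rightarrow> real"
  assumes "probability P" "positive P" "b \<le> c" "\<And>a e. (a, e) \<in> basics t \<Longrightarrow> e \<le> b"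
  shows "truth_prob P c t = truth_prob P b t"
proof -
  have "term_eval (cond_holds (filter (\<lambda>x. x \<le> b) \<beta>)) t = term_eval (cond_holds \<beta>) t" for \<beta>
    by (rule term_eval_cong) (use assms(4) in \<open>auto intro!: cond_holds_filter\<close>)
  then show ?thesis
    using ordering_expect_filter[OF assms(1-3), of "\<lambda>\<beta>. of_bool (term_eval (cond_holds \<beta>) t)"]
    by (simp add: truth_prob_def)
qed

lemma truth_prob_rec:
  fixes P :: "'a::{finite,boolean_algebra} \<Rightarrow> real"
  assumes P: "probability P" "positive P" and "t \<in> cond_terms"
  shows "truth_prob P top t = expect P (\<lambda>w. truth_prob P top (reduct w t)) (antecedent t)"
proof -
  define b where "b = antecedent t"
  have "b \<noteq> bot"
    using antecedent_neq_bot[OF assms(3) probability_top_neq_bot[OF P(1)]] by (simp add: b_def)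
  have "truth_prob P top t = truth_prob P b t"
    by (rule truth_prob_restrict[OF P top_greatest]) (simp add: b_def basics_le_antecedent)
  also have "\<dots> = (\<Sum>x\<in>atoms_below b. cond_prob P x b *
      ordering_expect P (inf b (- x)) (\<lambda>\<beta>. of_bool (term_eval (cond_holds (x # \<beta>)) t)))"
    unfolding truth_prob_def by (rule ordering_expect_rec[OF \<open>b \<noteq> bot\<close>])
  also have "\<dots> = (\<Sum>x\<in>atoms_below b. truth_prob P top (reduct (\<lambda>a. x \<le> a) t) * cond_prob P x b)"
  proof (rule sum.cong)
    fix x assume "x \<in> atoms_below b"
    then have x: "is_atom x" by (simp add: atoms_below_def)
    have "truth_prob P top (reduct (\<lambda>a. x \<le> a) t) =
        truth_prob P (inf b (- x)) (reduct (\<lambda>a. x \<le> a) t)"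
      using basics_reduct_le[OF x] unfolding b_def
      by (intro truth_prob_restrict[OF P top_greatest]) blast
    then show "cond_prob P x b *
        ordering_expect P (inf b (- x)) (\<lambda>\<beta>. of_bool (term_eval (cond_holds (x # \<beta>)) t)) =
        truth_prob P top (reduct (\<lambda>a. x \<le> a) t) * cond_prob P x b"
      by (simp add: truth_prob_def term_eval_reduct[OF x])
  qed simp
  finally show ?thesis by (simp add: expect_eq_sum_atoms[OF P(1)] b_def)
qed

lemma Pstar_One:
  fixes P :: "'a::{finite,boolean_algebra} \<Rightarrow> real"
  assumes "probability P"
  shows "Pstar P One = 1"
proof -
  have "rand_quant P One = (\<lambda>_. 1)" by (rule ext) (rule rand_quant_One)
  moreover have "P (antecedent One) \<noteq> 0"
    using assms by (simp add: antecedent_def probability_def)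
  ultimately show ?thesis by (simp add: Pstar_def expect_const[OF assms])
qed

lemma Pstar_Zero: "Pstar P Zero = 0"
  by (simp add: Pstar_def expect_def rand_quant_Zero)

lemma Pstar_rec:
  assumes "probability P" "t \<noteq> One" "t \<noteq> Zero"
  shows "Pstar P t = expect P (\<lambda>w. Pstar P (reduct w t)) (antecedent t)"
  by (simp add: Pstar_def rand_quant_rec[OF assms, abs_def])

lemma Pstar_eq_truth_prob:
  fixes P :: "'a::{finite,boolean_algebra} \<Rightarrow> real"
  assumes P: "probability P" "positive P" and "t \<in> cond_terms"
  shows "Pstar P t = truth_prob P top t"
  using \<open>t \<in> cond_terms\<close>
proof (induction "weight t" arbitrary: t rule: less_induct)
  case less
  consider "t = One" | "t = Zero" | "t \<noteq> One" "t \<noteq> Zero" by blast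
  then show ?case
  proof cases
    case 1
    then show ?thesis by (simp add: Pstar_One truth_prob_def ordering_expect_const P)
  next
    case 2
    then show ?thesis by (simp add: Pstar_Zero truth_prob_def ordering_expect_def)
  next
    case 3
    have "Pstar P t = expect P (\<lambda>w. Pstar P (reduct w t)) (antecedent t)"
      by (rule Pstar_rec[OF P(1) 3])
    also have "\<dots> = expect P (\<lambda>w. truth_prob P top (reduct w t)) (antecedent t)"
      using less 3
      by (intro expect_cong[OF P(1)]) (simp add: weight_reduct_less reduct_cond_terms)
    also have "\<dots> = truth_prob P top t"
      by (rule truth_prob_rec[OF P less.prems, symmetric])
    finally show ?thesis .
  qed
qed


section \<open>Valuations of conditionals\<close>

text \<open>These are the defining relations of \<open>\<C>(A)\<close>, so a valuation amounts to a homomorphism out of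
  \<open>\<C>(A)\<close>; the relation between \<open>(a \<and> b | b)\<close> and \<open>(a | b)\<close> follows from the others.\<close>

locale cond_valuation =
  fixes v :: "'a::{finite,boolean_algebra} \<times> 'a \<Rightarrow> 'b::boolean_algebra"
  assumes self: "b \<noteq> bot \<Longrightarrow> v (b, b) = top"
    and inf: "b \<noteq> bot \<Longrightarrow> v (inf a\<^sub>1 a\<^sub>2, b) = inf (v (a\<^sub>1, b)) (v (a\<^sub>2, b))"
    and uminus: "b \<noteq> bot \<Longrightarrow> v (- a, b) = - v (a, b)"
    and chain: "b \<noteq> bot \<Longrightarrow> a \<le> b \<Longrightarrow> b \<le> c \<Longrightarrow> v (a, c) = inf (v (a, b)) (v (b, c))"
begin

lemma restrict: "b \<noteq> bot \<Longrightarrow> v (inf a b, b) = v (a, b)"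
  by (simp add: inf self)

lemma bot: "b \<noteq> bot \<Longrightarrow> v (bot, b) = bot"
  using uminus[of b top] restrict[of b top] by (simp add: self)

lemma sup:
  assumes "b \<noteq> bot"
  shows "v (sup a\<^sub>1 a\<^sub>2, b) = sup (v (a\<^sub>1, b)) (v (a\<^sub>2, b))"
  using uminus[OF assms, of "inf (- a\<^sub>1) (- a\<^sub>2)"] by (simp add: inf uminus assms)

lemma mono: "b \<noteq> bot \<Longrightarrow> a \<le> a' \<Longrightarrow> v (a, b) \<le> v (a', b)"
  using sup[of b a a'] by (simp add: sup_absorb2 le_iff_sup)

lemma finitely_additive_comp:
  assumes "finitely_additive m" "b \<noteq> bot"
  shows "finitely_additive (\<lambda>a. m (inf y (v (a, b))))"
  unfolding finitely_additive_def
proof (intro allI impI)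
  fix a\<^sub>1 a\<^sub>2 :: 'a
  assume "inf a\<^sub>1 a\<^sub>2 = bot"
  then have "inf (v (a\<^sub>1, b)) (v (a\<^sub>2, b)) = bot" by (metis inf bot assms(2))
  moreover have "inf (inf y (v (a\<^sub>1, b))) (inf y (v (a\<^sub>2, b))) =
      inf y (inf (v (a\<^sub>1, b)) (v (a\<^sub>2, b)))"
    by (simp add: inf_aci)
  ultimately have "inf (inf y (v (a\<^sub>1, b))) (inf y (v (a\<^sub>2, b))) = bot" by simp
  then show "m (inf y (v (sup a\<^sub>1 a\<^sub>2, b))) = m (inf y (v (a\<^sub>1, b))) + m (inf y (v (a\<^sub>2, b)))"
    by (simp add: sup assms(2) inf_sup_distrib1 finitely_additiveD[OF assms(1)])
qed

end

lemma cond_holds_self: "\<exists>x\<in>set \<beta>. x \<le> b \<Longrightarrow> cond_holds \<beta> (b, b)"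
  by (induction \<beta>) auto

lemma cond_holds_inf:
  "cond_holds \<beta> (inf a\<^sub>1 a\<^sub>2, b) \<longleftrightarrow> cond_holds \<beta> (a\<^sub>1, b) \<and> cond_holds \<beta> (a\<^sub>2, b)"
  by (induction \<beta>) auto

lemma cond_holds_uminus:
  "\<forall>x\<in>set \<beta>. is_atom x \<Longrightarrow> \<exists>x\<in>set \<beta>. x \<le> b \<Longrightarrow>
    cond_holds \<beta> (- a, b) \<longleftrightarrow> \<not> cond_holds \<beta> (a, b)"
  by (induction \<beta>) (auto simp: is_atom_le_uminus)

lemma cond_holds_chain:
  "a \<le> b \<Longrightarrow> b \<le> c \<Longrightarrow> cond_holds \<beta> (a, c) \<longleftrightarrow> cond_holds \<beta> (a, b) \<and> cond_holds \<beta> (b, c)"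
  by (induction \<beta>) (auto intro: order_trans)

lemma cond_valuation_cond_holds:
  assumes "\<beta> \<in> orderings top"
  shows "cond_valuation (cond_holds \<beta>)"
proof -
  have set: "set \<beta> = Collect is_atom"
    using permutations_of_setD(1)[OF assms] by (simp add: atoms_below_def)
  then have "\<exists>x\<in>set \<beta>. x \<le> b" if "b \<noteq> bot" for b
    using ex_atom_below[OF that] by auto
  with set show ?thesis
    by unfold_locales
      (simp_all add: cond_holds_self cond_holds_inf cond_holds_uminus, rule cond_holds_chain)
qed

interpretation cond_class: cond_valuation "\<lambda>c. cond_class (Basic c)"
proof
  fix a a\<^sub>1 a\<^sub>2 b c :: 'a
  assume b: "b \<noteq> bot"
  note abs_eq = cond_class_def top_cond_alg.abs_eq inf_cond_alg.abs_eq uminus_cond_alg.abs_eq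
    cond_alg.abs_eq_iff
  show "cond_class (Basic (b, b)) = top"
    unfolding abs_eq by (rule cond_cong.cond_self[OF b])
  show "cond_class (Basic (inf a\<^sub>1 a\<^sub>2, b)) =
      inf (cond_class (Basic (a\<^sub>1, b))) (cond_class (Basic (a\<^sub>2, b)))"
    unfolding abs_eq by (rule cond_cong.sym[OF cond_cong.cond_inf[OF b]])
  show "cond_class (Basic (- a, b)) = - cond_class (Basic (a, b))"
    unfolding abs_eq by (rule cond_cong.sym[OF cond_cong.cond_uminus[OF b]])
  assume "a \<le> b" "b \<le> c"
  with b have "c \<noteq> bot" by (auto simp: bot_unique)
  with b \<open>a \<le> b\<close> \<open>b \<le> c\<close>
  show "cond_class (Basic (a, c)) = inf (cond_class (Basic (a, b))) (cond_class (Basic (b, c)))"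
    unfolding abs_eq by (intro cond_cong.sym[OF cond_cong.cond_chain])
qed

lemma term_eval_cond_class:
  "t \<in> cond_terms \<Longrightarrow> term_eval (\<lambda>c. cond_class (Basic c)) t = cond_class t"
  by (induction t) (simp_all add: cond_class_simps)

lemma term_eval_free_eq: "free_eq s t \<Longrightarrow> term_eval v s = term_eval v t"
  by (induction rule: free_eq.induct)
    (simp_all add: inf_aci sup_aci sup_inf_distrib1)

lift_definition free_eval ::
  "('a::boolean_algebra \<times> 'a \<Rightarrow> 'b::boolean_algebra) \<Rightarrow> 'a free_alg \<Rightarrow> 'b"
  is term_eval by (rule term_eval_free_eq)

lemma free_eval_simps:
  "free_eval v top = top" "free_eval v (- x) = - free_eval v x"
  "free_eval v (inf x y) = inf (free_eval v x) (free_eval v y)"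
  "free_eval v (sup x y) = sup (free_eval v x) (free_eval v y)"
  by (transfer, simp)+

lemma free_eval_abs: "t \<in> cond_terms \<Longrightarrow> free_eval v (abs_free_alg t) = term_eval v t"
  by (simp add: free_eval.abs_eq free_eq_refl_iff eq_onp_def)

lemma (in cond_valuation) free_eval_cond_cong:
  "cond_cong x y \<Longrightarrow> free_eval v x = free_eval v y"
proof (induction rule: cond_cong.induct)
  case (cond_chain b c a)
  then show ?case by (simp add: free_eval_simps free_eval_abs chain[of b a c])
qed (simp_all add: free_eval_simps free_eval_abs self inf uminus restrict)

lift_definition models :: "'a::{finite,boolean_algebra} cond_alg \<Rightarrow> 'a list set"
  is "\<lambda>x. {\<beta> \<in> orderings top. free_eval (cond_holds \<beta>) x}"
  using cond_valuation.free_eval_cond_cong cond_valuation_cond_holds by blast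

lemma models_cond_class:
  "t \<in> cond_terms \<Longrightarrow> models (cond_class t) = {\<beta> \<in> orderings top. term_eval (cond_holds \<beta>) t}"
  by (simp add: cond_class_def models.abs_eq free_eval_abs)

lemma models_simps:
  "models top = orderings top" "models (- x) = orderings top - models x"
  "models (inf x y) = models x \<inter> models y" "models (sup x y) = models x \<union> models y"
  by (transfer, auto simp: free_eval_simps)+

lemma finite_models [simp]: "finite (models x)"
  by transfer simp

lemma cond_class_surj:
  fixes x :: "'a::boolean_algebra cond_alg"
  obtains t where "t \<in> cond_terms" "cond_class t = x"
proof -
  obtain y where y: "x = abs_cond_alg y"
    by (metis Quotient3_cond_alg Quotient3_abs_rep)
  have "free_eq (rep_free_alg y) (rep_free_alg y)" "abs_free_alg (rep_free_alg y) = y"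
    by (auto simp: Quotient3_rep_reflp[OF Quotient3_free_alg]
        Quotient3_abs_rep[OF Quotient3_free_alg])
  then show ?thesis
    using that[of "rep_free_alg y"] y by (simp add: cond_class_def free_eq_refl_iff)
qed


section \<open>The atoms of the algebra of conditionals\<close>

text \<open>In contrast to \<open>omega\<close>, applied below to orderings of all atoms below \<open>c\<close>: the last factor
  \<open>(x | x)\<close> is then trivial.\<close>

fun omega_eval :: "('a::boolean_algebra \<times> 'a \<Rightarrow> 'b::boolean_algebra) \<Rightarrow> 'a \<Rightarrow> 'a list \<Rightarrow> 'b" where
  "omega_eval v c [] = top"
| "omega_eval v c (x # \<beta>) = inf (v (x, c)) (omega_eval v (inf c (- x)) \<beta>)"

lemma omega_eval_cond_holds_Cons:
  assumes "is_atom x" "c \<le> - x"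
  shows "omega_eval (cond_holds (x # \<gamma>)) c \<beta> = omega_eval (cond_holds \<gamma>) c \<beta>"
  using assms(2)
  by (induction \<beta> arbitrary: c) (auto simp: le_uminus_is_atom assms(1) intro: le_infI1)

lemma omega_eval_cond_holds:
  assumes "\<beta> \<in> orderings c" "\<delta> \<in> orderings c"
  shows "omega_eval (cond_holds \<delta>) c \<beta> \<longleftrightarrow> \<delta> = \<beta>"
  using assms
proof (induction arbitrary: \<delta> rule: ordering_induct)
  case Nil
  then show ?case by simp
next
  case (Cons c x \<beta>)
  then obtain y \<gamma> where \<delta>: "\<delta> = y # \<gamma>" "y \<in> atoms_below c" "\<gamma> \<in> orderings (inf c (- y))"
    by (cases \<delta>) (auto simp: Nil_in_orderings_iff Cons_in_orderings_iff)
  have "cond_holds \<delta> (x, c) \<longleftrightarrow> y = x"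
    using \<delta>(2) Cons.hyps(2) by (auto simp: \<delta>(1) atoms_below_def is_atom_le_atom)
  moreover have "omega_eval (cond_holds \<delta>) (inf c (- x)) \<beta> \<longleftrightarrow> \<gamma> = \<beta>" if "y = x"
    using that Cons.IH[of \<gamma>] Cons.hyps(2) \<delta>
    by (simp add: omega_eval_cond_holds_Cons atoms_below_def del: cond_holds.simps)
  ultimately show ?case by (auto simp: \<delta>(1) simp del: cond_holds.simps)
qed

lemma atoms_below_singleton:
  assumes "x \<in> atoms_below c" "[] \<in> orderings (inf c (- x))"
  shows "c = x"
  using assms(1) assms(2)[unfolded Nil_in_orderings_iff]
  by (auto simp: atoms_below_def inf_shunt intro: antisym)

lemma omega_butlast_cond_terms:
  assumes "\<beta> \<in> orderings c"
  shows "omega c (butlast \<beta>) \<in> cond_terms"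
  using assms
proof (induction rule: ordering_induct)
  case (Cons c x \<beta>)
  then show ?case by (cases "butlast \<beta>") auto
qed simp

lemma omega_value_butlast:
  fixes P :: "'a::{finite,boolean_algebra} \<Rightarrow> real"
  assumes "positive P" "\<beta> \<in> orderings c"
  shows "omega_value P c (butlast \<beta>) = omega_value P c \<beta>"
  using assms(2)
proof (induction rule: ordering_induct)
  case (Cons c x \<beta>)
  show ?case
  proof (cases "\<beta> = []")
    case True
    then have "c = x" using Cons.hyps atoms_below_singleton by blast
    then show ?thesis
      using True cond_prob_self positive_neq_0[OF assms(1) Cons.hyps(1)] by auto
  qed (simp add: Cons.IH)
qed simp

lemma atom_seqs_eq_butlast_orderings: "atom_seqs = butlast ` orderings top"
proof (intro subset_antisym subsetI)
  fix \<gamma> :: "'a list"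
  let ?A = "{a::'a. is_atom a}"
  have atoms: "atoms_below top = ?A" by (simp add: atoms_below_def)
  assume "\<gamma> \<in> atom_seqs"
  then have \<gamma>: "distinct \<gamma>" "set \<gamma> \<subseteq> ?A" "length \<gamma> = card ?A - 1"
    by (auto simp: atom_seqs_def)
  show "\<gamma> \<in> butlast ` orderings top"
  proof (cases "?A = {}")
    case True
    with \<gamma> show ?thesis by (simp add: atoms)
  next
    case False
    then have "card (?A - set \<gamma>) = 1"
      using \<gamma> distinct_card[OF \<gamma>(1)] by (simp add: card_Diff_subset card_gt_0_iff Suc_leI)
    then obtain x where "?A - set \<gamma> = {x}" by (rule card_1_singletonE)
    then have "\<gamma> @ [x] \<in> orderings top"
      using \<gamma> by (auto simp: permutations_of_set_def atoms)
    then show ?thesis by (rule rev_image_eqI) simp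
  qed
next
  fix \<gamma> :: "'a list"
  assume "\<gamma> \<in> butlast ` orderings top"
  then obtain \<beta> where \<beta>: "\<gamma> = butlast \<beta>" "set \<beta> = Collect is_atom" "distinct \<beta>"
    by (auto simp: permutations_of_set_def atoms_below_def)
  then show "\<gamma> \<in> atom_seqs"
    using distinct_card[OF \<beta>(3)]
    by (auto simp: atom_seqs_def distinct_butlast dest: in_set_butlastD)
qed

context cond_valuation
begin

lemma term_eval_omega_butlast:
  assumes "\<beta> \<in> orderings c"
  shows "term_eval v (omega c (butlast \<beta>)) = omega_eval v c \<beta>"
  using assms
proof (induction rule: ordering_induct)
  case (Cons c x \<beta>)
  show ?case
  proof (cases "\<beta> = []")
    case True
    then have "c = x" using Cons.hyps atoms_below_singleton by blast
    then show ?thesis using True Cons.hyps(1) by (simp add: self)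
  next
    case False
    then show ?thesis using Cons.IH by (cases "butlast \<beta>") simp_all
  qed
qed simp

lemma omega_eval_le:
  assumes "\<beta> \<in> orderings c" "b \<le> c" "b \<noteq> bot" "cond_holds \<beta> (a, b)"
  shows "omega_eval v c \<beta> \<le> v (a, b)"
  using assms(1,2,4)
proof (induction rule: ordering_induct)
  case (Cons c x \<beta>)
  show ?case
  proof (cases "x \<le> b")
    case True
    have "v (x, c) \<le> v (x, b)"
      by (simp add: chain[OF assms(3) True Cons.prems(1)])
    also have "\<dots> \<le> v (a, b)"
      using True Cons.prems(2) by (intro mono assms(3)) simp
    finally show ?thesis by (simp add: le_infI1)
  next
    case False
    then have "b \<le> inf c (- x)"
      using Cons.prems(1) Cons.hyps(2) by (simp add: atoms_below_def le_uminus_is_atom)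
    then show ?thesis
      using False Cons.IH Cons.prems(2) by (simp add: le_infI2)
  qed
qed simp

lemma omega_eval_decides:
  assumes "\<beta> \<in> orderings top" "t \<in> cond_terms"
  shows "omega_eval v top \<beta> \<le>
    (if term_eval (cond_holds \<beta>) t then term_eval v t else - term_eval v t)"
  using assms(2)
proof (induction t)
  case (Basic c)
  obtain a b where c: "c = (a, b)" "b \<noteq> bot" using Basic by (cases c) simp
  interpret holds: cond_valuation "cond_holds \<beta>"
    by (rule cond_valuation_cond_holds[OF assms(1)])
  show ?case
    using omega_eval_le[OF assms(1) top_greatest c(2), of a]
      omega_eval_le[OF assms(1) top_greatest c(2), of "- a"]
    by (simp add: c uminus holds.uminus)
qed (auto split: if_splits intro: le_infI1 le_infI2 le_supI1 le_supI2)

lemma inf_omega_eval: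
  assumes "\<beta> \<in> orderings top" "t \<in> cond_terms"
  shows "inf (term_eval v t) (omega_eval v top \<beta>) =
    (if term_eval (cond_holds \<beta>) t then omega_eval v top \<beta> else bot)"
proof (cases "term_eval (cond_holds \<beta>) t")
  case True
  then show ?thesis using omega_eval_decides[OF assms] by (simp add: inf_absorb2)
next
  case False
  then have "inf (omega_eval v top \<beta>) (term_eval v t) = bot"
    using omega_eval_decides[OF assms] by (simp add: inf_shunt)
  with False show ?thesis by (simp add: inf.commute)
qed

lemma sum_inf_omega_eval:
  assumes "finitely_additive m"
  shows "(\<Sum>\<beta>\<in>orderings c. m (inf y (omega_eval v c \<beta>))) = m y"
proof (induction c arbitrary: y rule: remove_atom_induct)
  case bot
  show ?case by simp
next
  case (remove c)
  have "(\<Sum>\<beta>\<in>orderings c. m (inf y (omega_eval v c \<beta>))) =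
      (\<Sum>x\<in>atoms_below c. \<Sum>\<beta>\<in>orderings (inf c (- x)).
        m (inf (inf y (v (x, c))) (omega_eval v (inf c (- x)) \<beta>)))"
    by (simp add: sum_orderings[OF remove.hyps] inf.assoc)
  also have "\<dots> = (\<Sum>x\<in>atoms_below c. m (inf y (v (x, c))))"
    by (rule sum.cong) (simp_all only: remove.IH)
  also have "\<dots> = m (inf y (v (c, c)))"
    by (rule finitely_additive_eq_sum_atoms[OF finitely_additive_comp[OF assms remove.hyps],
          symmetric])
  finally show ?case by (simp add: self[OF remove.hyps])
qed

end

lemma cond_class_omega_butlast:
  assumes "\<beta> \<in> orderings c"
  shows "cond_class (omega c (butlast \<beta>)) = omega_eval (\<lambda>c. cond_class (Basic c)) c \<beta>"
  using cond_class.term_eval_omega_butlast[OF assms] omega_butlast_cond_terms[OF assms]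
  by (simp add: term_eval_cond_class)

lemma models_omega_butlast:
  assumes "\<beta> \<in> orderings top"
  shows "models (cond_class (omega top (butlast \<beta>))) = {\<beta>}"
proof -
  have "term_eval (cond_holds \<delta>) (omega top (butlast \<beta>)) \<longleftrightarrow> \<delta> = \<beta>"
    if "\<delta> \<in> orderings top" for \<delta>
    using cond_valuation.term_eval_omega_butlast[OF cond_valuation_cond_holds[OF that] assms]
      omega_eval_cond_holds[OF assms that] by simp
  then show ?thesis
    using assms by (auto simp: models_cond_class omega_butlast_cond_terms)
qed

lemma finitely_additive_eq_sum_models:
  fixes m :: "'a::{finite,boolean_algebra} cond_alg \<Rightarrow> 'b::cancel_comm_monoid_add"
  assumes "finitely_additive m"
  shows "m y = (\<Sum>\<beta>\<in>models y. m (cond_class (omega top (butlast \<beta>))))"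
proof -
  obtain t where t: "t \<in> cond_terms" "cond_class t = y" by (rule cond_class_surj)
  have "m y = (\<Sum>\<beta>\<in>orderings top. m (inf y (omega_eval (\<lambda>c. cond_class (Basic c)) top \<beta>)))"
    by (rule cond_class.sum_inf_omega_eval[OF assms, symmetric])
  also have "\<dots> = (\<Sum>\<beta>\<in>orderings top.
      if term_eval (cond_holds \<beta>) t then m (cond_class (omega top (butlast \<beta>))) else 0)"
    using cond_class.inf_omega_eval[OF _ t(1)] t(2)
    by (intro sum.cong)
      (simp_all add: term_eval_cond_class t(1) cond_class_omega_butlast
        finitely_additive_bot[OF assms])
  also have "\<dots> = (\<Sum>\<beta>\<in>models y. m (cond_class (omega top (butlast \<beta>))))"
    by (simp add: models_cond_class[OF t(1)] t(2)[symmetric] sum.inter_filter)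
  finally show ?thesis .
qed


section \<open>The canonical extension as the law of a random ordering\<close>

definition ordering_measure ::
  "('a::{finite,boolean_algebra} \<Rightarrow> real) \<Rightarrow> 'a cond_alg \<Rightarrow> real" where
  "ordering_measure P x = (\<Sum>\<beta>\<in>models x. omega_value P top \<beta>)"

lemma truth_prob_eq_ordering_measure:
  assumes "t \<in> cond_terms"
  shows "truth_prob P top t = ordering_measure P (cond_class t)"
  by (simp add: truth_prob_def ordering_expect_def ordering_measure_def models_cond_class[OF assms]
      sum.inter_filter of_bool_def if_distrib cong: if_cong)

lemma omega_value_nonneg:
  assumes "probability P"
  shows "0 \<le> omega_value P c \<beta>"
  using assms by (induction \<beta> arbitrary: c) (auto simp: cond_prob_def probability_def)

lemma probability_ordering_measure:
  fixes P :: "'a::{finite,boolean_algebra} \<Rightarrow> real"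
  assumes "probability P" "positive P"
  shows "probability (ordering_measure P)"
  unfolding probability_def
proof (intro conjI allI impI)
  fix x y :: "'a cond_alg"
  show "0 \<le> ordering_measure P x"
    by (simp add: ordering_measure_def sum_nonneg omega_value_nonneg assms)
  show "ordering_measure P top = 1"
    using ordering_expect_const[OF assms, of top 1]
    by (simp add: ordering_measure_def models_simps ordering_expect_def)
  assume "inf x y = bot"
  then have "models x \<inter> models y = models (- top)" by (simp add: models_simps(3)[symmetric])
  then have "models x \<inter> models y = {}" by (simp only: models_simps) simp
  then show "ordering_measure P (sup x y) = ordering_measure P x + ordering_measure P y"
    by (simp add: ordering_measure_def models_simps sum.union_disjoint)
qed

lemma ordering_measure_omega:
  fixes P :: "'a::{finite,boolean_algebra} \<Rightarrow> real"
  assumes "positive P" "\<beta> \<in> atom_seqs"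
  shows "ordering_measure P (cond_class (omega top \<beta>)) = omega_value P top \<beta>"
  using assms
  by (auto simp: atom_seqs_eq_butlast_orderings ordering_measure_def models_omega_butlast
      omega_value_butlast)

lemma mu_eq_ordering_measure:
  fixes P :: "'a::{finite,boolean_algebra} \<Rightarrow> real"
  assumes "probability P" "positive P"
  shows "mu P = ordering_measure P"
  unfolding mu_def
proof (rule the_equality)
  show "probability (ordering_measure P) \<and>
      (\<forall>\<beta>\<in>atom_seqs. ordering_measure P (cond_class (omega top \<beta>)) = omega_value P top \<beta>)"
    by (simp add: probability_ordering_measure ordering_measure_omega assms)
next
  fix m :: "'a cond_alg \<Rightarrow> real"
  assume m: "probability m \<and>
      (\<forall>\<beta>\<in>atom_seqs. m (cond_class (omega top \<beta>)) = omega_value P top \<beta>)"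
  show "m = ordering_measure P"
  proof
    fix y :: "'a cond_alg"
    have "m y = (\<Sum>\<beta>\<in>models y. m (cond_class (omega top (butlast \<beta>))))"
      by (rule finitely_additive_eq_sum_models) (simp add: probability_finitely_additive m)
    also have "\<dots> = ordering_measure P y"
      unfolding ordering_measure_def
    proof (rule sum.cong)
      fix \<beta> assume "\<beta> \<in> models y"
      then have "\<beta> \<in> orderings top" by transfer simp
      then show "m (cond_class (omega top (butlast \<beta>))) = omega_value P top \<beta>"
        using m by (simp add: atom_seqs_eq_butlast_orderings omega_value_butlast assms(2))
    qed simp
    finally show "m y = ordering_measure P y" .
  qed
qed

theorem theorem6p4:
  fixes P :: "'a::{finite,boolean_algebra} \<Rightarrow> real"
    and t :: "'a cond_term"
  assumes "probability P" and "positive P" and "t \<in> cond_terms"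
  shows "Pstar P t = mu P (cond_class t)"
proof -
  have "Pstar P t = truth_prob P top t"
    by (rule Pstar_eq_truth_prob[OF assms])
  also have "\<dots> = ordering_measure P (cond_class t)"
    by (rule truth_prob_eq_ordering_measure[OF assms(3)])
  also have "\<dots> = mu P (cond_class t)"
    by (simp only: mu_eq_ordering_measure[OF assms(1,2)])
  finally show ?thesis .
qed

end
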